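(* For infinitely many positive integers $n$, there exist graphs on $n$ vertices such that adding an edge strictly increases the expected propagation time. Specifically, \[\operatorname{ept}(T_{4,m})=\frac{m-1}{2}+\frac{451}{216}=\frac{m-1}{2}+\frac{1353}{648}\quad\text{and}\quad \operatorname{ept}(T'_{4,m})=\frac{m-1}{2}+\frac{1429}{648}\] when $m$ is odd, and \[\operatorname{ept}(T_{4,m})=\frac{m}{2}+\frac{3331}{1944}=\frac{m}{2}+\frac{9993}{5832}\quad\text{and}\quad \operatorname{ept}(T'_{4,m})=\frac{m}{2}+\frac{10357}{5832}\] when $m$ is even.
   Context: Graphs are finite, simple and undirected. $N[u]=N(u)\cup\{u\}$ is the closed neighborhood of $u$. Probabilistic zero forcing: each vertex of a connected graph $G$ is blue or white. In one round, with $C$ the set of vertices that are blue at the start of the round, every blue vertex $u$ attempts to force each of its white neighbors $w$, all attempts being independent, each succeeding with probability $\Pr(u\to w)=\frac{|N[u]\cap C|}{\deg u}$. A white vertex becomes blue in the round if at least one blue neighbor succeeds in forcing it; blue vertices stay blue. For a nonempty set $B$ of vertices, $\operatorname{pt}_{pzf}(G,B)$ is the random number of the round in which the last white vertex turns blue when initially exactly the vertices in $B$ are blue (it is $0$ if $B=V(G)$), and $\operatorname{ept}(G,B)=\mathbf{E}[\operatorname{pt}_{pzf}(G,B)]$. The expected propagation time of a connected graph $G$ is $\operatorname{ept}(G)=\min\{\operatorname{ept}(G,\{v\}):v\in V(G)\}$. The tadpole graph $T_{4,m}$ is the union $C_4\cup P_m$ of the 4-cycle with vertices $p_1,c_2,c_3,c_4$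 labeled cyclically and the path on $m$ vertices $p_1,\dots,p_m$ labeled in path order, sharing exactly the vertex $p_1$ (so it has $m+3$ vertices). $T'_{4,m}$ is obtained from $T_{4,m}$ by adding the edge $c_2c_4$.
   Formalization: The formulas for ept(T_{4,m}) and ept(T'_{4,m}) are stated for m ≥ 5 only; for m = 1, 2, 3, 4 they are false (e.g. T_{4,1} is the 4-cycle, with expected propagation time 7/3, not 451/216). *)

theory Defs
  imports "HOL-Probability.Probability" "Graph_Theory.Graph_Theory"
begin

text \<open>
  A finite simple undirected graph is a \<open>pair_graph\<close>: each edge \<open>uv\<close> is represented
  by the two arcs \<open>(u, v)\<close> and \<open>(v, u)\<close>.
\<close>

definition nbhd :: "'a pair_pre_digraph \<Rightarrow> 'a \<Rightarrow> 'a set" where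
  "nbhd G u = {w. (u, w) \<in> parcs G}"

definition closed_nbhd :: "'a pair_pre_digraph \<Rightarrow> 'a \<Rightarrow> 'a set" where
  "closed_nbhd G u = insert u (nbhd G u)"

definition add_edge :: "'a pair_pre_digraph \<Rightarrow> 'a \<Rightarrow> 'a \<Rightarrow> 'a pair_pre_digraph" where
  "add_edge G u v = \<lparr>pverts = pverts G, parcs = parcs G \<union> {(u, v), (v, u)}\<rparr>"

definition force_prob :: "'a pair_pre_digraph \<Rightarrow> 'a set \<Rightarrow> 'a \<Rightarrow> real" where
  "force_prob G C u = real (card (closed_nbhd G u \<inter> C)) / real (card (nbhd G u))"

text \<open>
  The randomness of one round is a family of independent variables, uniform on \<open>[0, 1]\<close>, one
  for each arc. The attempt of the blue vertex \<open>u\<close> to force its white neighbor \<open>w\<close>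
  succeeds iff the variable of the arc \<open>(u, w)\<close> is below the forcing probability of \<open>u\<close>.
  The rounds use independent copies, so a sample point of the process is a stream.
\<close>

definition round_space :: "'a pair_pre_digraph \<Rightarrow> ('a \<times> 'a \<Rightarrow> real) measure" where
  "round_space G = (\<Pi>\<^sub>M e\<in>parcs G. uniform_measure lborel {0..1})"

definition pzf_space :: "'a pair_pre_digraph \<Rightarrow> ('a \<times> 'a \<Rightarrow> real) stream measure" where
  "pzf_space G = stream_space (round_space G)"

definition pzf_round :: "'a pair_pre_digraph \<Rightarrow> 'a set \<Rightarrow> ('a \<times> 'a \<Rightarrow> real) \<Rightarrow> 'a set" where
  "pzf_round G C x =
     C \<union> {w \<in> pverts G - C. \<exists>u\<in>C. w \<in> nbhd G u \<and> x (u, w) < force_prob G C u}"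

primrec blue ::
  "'a pair_pre_digraph \<Rightarrow> 'a set \<Rightarrow> ('a \<times> 'a \<Rightarrow> real) stream \<Rightarrow> nat \<Rightarrow> 'a set" where
  "blue G B \<omega> 0 = B"
| "blue G B \<omega> (Suc t) = pzf_round G (blue G B \<omega> t) (\<omega> !! t)"

text \<open>The infimum of the empty set is \<open>\<infinity>\<close>: on some sample paths a vertex stays white forever.\<close>

definition pt_pzf ::
  "'a pair_pre_digraph \<Rightarrow> 'a set \<Rightarrow> ('a \<times> 'a \<Rightarrow> real) stream \<Rightarrow> enat" where
  "pt_pzf G B \<omega> = (INF t\<in>{t. blue G B \<omega> t = pverts G}. enat t)"

definition ept_from :: "'a pair_pre_digraph \<Rightarrow> 'a set \<Rightarrow> ennreal" where
  "ept_from G B = (\<integral>\<^sup>+ \<omega>. ennreal_of_enat (pt_pzf G B \<omega>) \<partial>pzf_space G)"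

definition ept :: "'a pair_pre_digraph \<Rightarrow> ennreal" where
  "ept G = Min ((\<lambda>v. ept_from G {v}) ` pverts G)"

text \<open>
  In the tadpole graph, for \<open>m \<ge> 1\<close>, the path vertex \<open>p\<^sub>i\<close> is \<open>i\<close> (where \<open>1 \<le> i \<le> m\<close>), and
  \<open>c\<^sub>2\<close>, \<open>c\<^sub>3\<close>, \<open>c\<^sub>4\<close> are \<open>m + 1\<close>, \<open>m + 2\<close>, \<open>m + 3\<close>.
\<close>

definition tadpole_arcs :: "nat \<Rightarrow> (nat \<times> nat) set" where
  "tadpole_arcs m =
     {(i, i + 1) | i. 1 \<le> i \<and> i < m} \<union> {(1, m + 1), (m + 1, m + 2), (m + 2, m + 3), (m + 3, 1)}"

definition tadpole :: "nat \<Rightarrow> nat pair_pre_digraph" where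
  "tadpole m = \<lparr>pverts = {1..m + 3}, parcs = tadpole_arcs m \<union> (tadpole_arcs m)\<inverse>\<rparr>"

definition tadpole' :: "nat \<Rightarrow> nat pair_pre_digraph" where
  "tadpole' m = add_edge (tadpole m) (m + 1) (m + 3)"

end

theory Submission
  imports Defs
begin

text \<open>
  The process is a Markov chain on sets of blue vertices, so expected propagation times satisfy
  one-step equations. On the path, a single inner vertex waits for its first success (\<open>4 / 3\<close>
  rounds on average); from then on two adjacent blue vertices make both fronts advance with
  certainty. Randomness returns only when the left front reaches \<open>p\<^sub>1\<close>: with probability \<open>8 / 9\<close>
  per round \<open>p\<^sub>1\<close> forces at least one of \<open>c\<^sub>2, c\<^sub>4\<close>, after which one more round fills the cycle, except
  that the chord raises the degrees of \<open>c\<^sub>2\<close> and \<open>c\<^sub>4\<close> and may delay \<open>c\<^sub>3\<close> by a further round. The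
  optimal start lies near the middle of the path; the remaining starts are excluded by lower
  bounds, those at the end vertices and in the cycle essentially by distance.
\<close>

subsection \<open>The randomness of one round\<close>

lemma prob_space_uniform01: "prob_space (uniform_measure lborel {0..1::real})"
  by (rule prob_space_uniform_measure) auto

lemma emeasure_uniform01_less:
  assumes "0 \<le> q" "q \<le> 1"
  shows "emeasure (uniform_measure lborel {0..1::real}) {..<q} = ennreal q"
proof -
  have "{0..1} \<inter> {..<q} = {0..<q}" using assms by auto
  then show ?thesis using assms divide_ennreal[of q 1] by simp
qed

lemma emeasure_uniform01_atLeast:
  assumes "0 \<le> q" "q \<le> 1"
  shows "emeasure (uniform_measure lborel {0..1::real}) {q..} = ennreal (1 - q)"
proof -
  have "{0..1} \<inter> {q..} = {q..1}" using assms by auto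
  then show ?thesis using assms divide_ennreal[of "1 - q" 1] by simp
qed

text \<open>A force of probability 1 succeeds iff its variable is strictly below 1. The sample value
  1 lies in the interval, so such forces succeed only almost surely.\<close>

lemma AE_uniform01_less_1: "AE x in uniform_measure lborel {0..1::real}. x < 1"
proof -
  have "AE x in lborel. x \<noteq> (1::real)" by (rule AE_lborel_singleton)
  then have "AE x in lborel. x \<in> {0..1::real} \<longrightarrow> x < 1" by eventually_elim auto
  then show ?thesis by (subst AE_uniform_measure) auto
qed

lemma prob_space_round_space: "prob_space (round_space G)"
  unfolding round_space_def by (intro prob_space_PiM prob_space_uniform01)

lemma prob_space_pzf_space: "prob_space (pzf_space G)"
  unfolding pzf_space_def
  by (rule prob_space.prob_space_stream_space[OF prob_space_round_space])

lemma measurable_component_round_space [measurable]: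
  assumes "e \<in> parcs G"
  shows "(\<lambda>x. x e) \<in> borel_measurable (round_space G)"
  using measurable_component_singleton[OF assms, of "\<lambda>_. uniform_measure lborel {0..1::real}"]
  unfolding round_space_def by (simp add: measurable_def)

lemma emeasure_round_space_two:
  assumes "finite (parcs G)" "e1 \<in> parcs G" "e2 \<in> parcs G" "e1 \<noteq> e2"
    and "A \<in> sets borel" "B \<in> sets borel"
  shows "emeasure (round_space G) {x \<in> space (round_space G). x e1 \<in> A \<and> x e2 \<in> B} =
    emeasure (uniform_measure lborel {0..1}) A * emeasure (uniform_measure lborel {0..1}) B"
proof -
  interpret U: prob_space "uniform_measure lborel {0..1::real}" by (rule prob_space_uniform01)
  interpret P: finite_product_prob_space "\<lambda>_. uniform_measure lborel {0..1::real}" "parcs G"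
    by unfold_locales (use assms in auto)
  \<comment> \<open>The event is a box whose sides off \<open>e1\<close> and \<open>e2\<close> are
    \<open>UNIV\<close>; those factors of the product measure are 1.\<close>
  define X where "X e = (if e = e1 then A else if e = e2 then B else UNIV)" for e
  have "{x \<in> space (round_space G). x e1 \<in> A \<and> x e2 \<in> B} = Pi\<^sub>E (parcs G) X"
  proof (intro set_eqI iffI)
    fix x assume "x \<in> {x \<in> space (round_space G). x e1 \<in> A \<and> x e2 \<in> B}"
    then show "x \<in> Pi\<^sub>E (parcs G) X"
      by (simp add: round_space_def space_PiM PiE_iff X_def)
  next
    fix x assume x: "x \<in> Pi\<^sub>E (parcs G) X"
    then have "x e1 \<in> X e1" "x e2 \<in> X e2" using assms(2,3) by blast+
    with x assms(4) show "x \<in> {x \<in> space (round_space G). x e1 \<in> A \<and> x e2 \<in> B}"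
      by (simp add: round_space_def space_PiM PiE_iff X_def)
  qed
  also have "emeasure (round_space G) \<dots> =
      (\<Prod>e\<in>parcs G. emeasure (uniform_measure lborel {0..1}) (X e))"
    unfolding round_space_def
    by (rule P.emeasure_PiM) (use assms in \<open>auto simp: X_def\<close>)
  also have "\<dots> = (\<Prod>e\<in>{e1, e2}. emeasure (uniform_measure lborel {0..1}) (X e))"
    by (rule prod.mono_neutral_right)
       (use assms U.emeasure_space_1 in \<open>auto simp: X_def\<close>)
  finally show ?thesis using assms by (simp add: X_def)
qed

text \<open>In every state whose value is computed exactly, at most two attempts have an uncertain
  effect, so four outcomes describe a round; independence supplies the weights.\<close>

lemma nn_integral_round_space_two:
  fixes f :: "bool \<Rightarrow> bool \<Rightarrow> ennreal"
  assumes G: "finite (parcs G)" "e1 \<in> parcs G" "e2 \<in> parcs G" "e1 \<noteq> e2"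
    and q: "0 \<le> p" "p \<le> 1" "0 \<le> q" "q \<le> 1"
  shows "(\<integral>\<^sup>+x. f (x e1 < p) (x e2 < q) \<partial>round_space G) =
    ennreal (p * q) * f True True + ennreal (p * (1 - q)) * f True False
    + ennreal ((1 - p) * q) * f False True + ennreal ((1 - p) * (1 - q)) * f False False"
proof -
  let ?S = "\<lambda>A B. {x \<in> space (round_space G). x e1 \<in> A \<and> x e2 \<in> B}"
  have meas: "?S A B \<in> sets (round_space G)" if [measurable]: "A \<in> sets borel" "B \<in> sets borel" for A B
    using G by measurable
  have "(\<integral>\<^sup>+x. f (x e1 < p) (x e2 < q) \<partial>round_space G) =
     (\<integral>\<^sup>+x. f True True * indicator (?S {..<p} {..<q}) x + f True False * indicator (?S {..<p} {q..}) x
        + f False True * indicator (?S {p..} {..<q}) x + f False False * indicator (?S {p..} {q..}) x \<partial>round_space G)"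
    by (rule nn_integral_cong) (auto simp: indicator_def)
  also have "\<dots> = f True True * emeasure (round_space G) (?S {..<p} {..<q})
      + f True False * emeasure (round_space G) (?S {..<p} {q..})
      + f False True * emeasure (round_space G) (?S {p..} {..<q})
      + f False False * emeasure (round_space G) (?S {p..} {q..})"
    using meas by (simp add: nn_integral_add nn_integral_cmult_indicator del: mem_Collect_eq lessThan_iff atLeast_iff)
  also have "emeasure (round_space G) (?S {..<p} {..<q}) = ennreal (p * q)"
    by (subst emeasure_round_space_two[OF G])
       (use q in \<open>simp_all add: emeasure_uniform01_less emeasure_uniform01_atLeast ennreal_mult
        del: emeasure_uniform_measure\<close>)
  also have "emeasure (round_space G) (?S {..<p} {q..}) = ennreal (p * (1 - q))"
    by (subst emeasure_round_space_two[OF G])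
       (use q in \<open>simp_all add: emeasure_uniform01_less emeasure_uniform01_atLeast ennreal_mult
        del: emeasure_uniform_measure\<close>)
  also have "emeasure (round_space G) (?S {p..} {..<q}) = ennreal ((1 - p) * q)"
    by (subst emeasure_round_space_two[OF G])
       (use q in \<open>simp_all add: emeasure_uniform01_less emeasure_uniform01_atLeast ennreal_mult
        del: emeasure_uniform_measure\<close>)
  also have "emeasure (round_space G) (?S {p..} {q..}) = ennreal ((1 - p) * (1 - q))"
    by (subst emeasure_round_space_two[OF G])
       (use q in \<open>simp_all add: emeasure_uniform01_less emeasure_uniform01_atLeast ennreal_mult
        del: emeasure_uniform_measure\<close>)
  finally show ?thesis by (simp add: mult.commute)
qed

lemma ennreal_of_enat_eSuc: "ennreal_of_enat (eSuc n) = 1 + ennreal_of_enat n"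
  by (cases n) (auto simp: eSuc_enat)

subsection \<open>One-step equations\<close>

context pair_fin_digraph
begin

lemma AE_round_space_less_1: "AE x in round_space G. \<forall>e\<in>parcs G. x e < 1"
proof (rule AE_finite_allI[OF pair_finite_arcs])
  fix e assume e: "e \<in> parcs G"
  show "AE x in round_space G. x e < 1"
    unfolding round_space_def
    by (rule AE_PiM_component[OF prob_space_uniform01 e AE_uniform01_less_1])
qed

section \<open>Measurability of the state and of the propagation time\<close>

lemma pzf_round_subset: "C \<subseteq> pverts G \<Longrightarrow> pzf_round G C x \<subseteq> pverts G"
  by (auto simp: pzf_round_def)

text \<open>There are finitely many states, so preimages of singletons suffice, and each is a finite
  Boolean combination of comparisons of one arc variable with a constant.\<close>

lemma measurable_pzf_round:
  assumes "C \<subseteq> pverts G"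
  shows "pzf_round G C \<in> round_space G \<rightarrow>\<^sub>M count_space (Pow (pverts G))"
proof (subst measurable_count_space_eq2)
  show "finite (Pow (pverts G))" using pair_finite_verts by simp
  have "pzf_round G C -` {S} \<inter> space (round_space G) \<in> sets (round_space G)" if "S \<subseteq> pverts G" for S
  proof -
    have "pzf_round G C -` {S} \<inter> space (round_space G) =
      {x \<in> space (round_space G). \<forall>w\<in>pverts G.
         (w \<in> C \<or> (\<exists>e\<in>{e\<in>parcs G. fst e \<in> C \<and> snd e = w}. x e < force_prob G C (fst e))) \<longleftrightarrow> w \<in> S}"
      using assms that by (fastforce simp: pzf_round_def nbhd_def)
    also have "\<dots> \<in> sets (round_space G)"
      using pair_finite_verts pair_finite_arcs by measurable
    finally show ?thesis .
  qed
  then show "pzf_round G C \<in> space (round_space G) \<rightarrow> Pow (pverts G) \<and>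
    (\<forall>S\<in>Pow (pverts G). pzf_round G C -` {S} \<inter> space (round_space G) \<in> sets (round_space G))"
    using pzf_round_subset[OF assms] by blast
qed

lemma measurable_blue:
  assumes "C \<subseteq> pverts G"
  shows "(\<lambda>\<omega>. blue G C \<omega> t) \<in> pzf_space G \<rightarrow>\<^sub>M count_space (Pow (pverts G))"
proof (induction t)
  case 0
  then show ?case using assms by simp
next
  case (Suc t)
  have "(\<lambda>\<omega>. pzf_round G (blue G C \<omega> t) (\<omega> !! t)) \<in> pzf_space G \<rightarrow>\<^sub>M count_space (Pow (pverts G))"
  \<comment> \<open>The thresholds of round \<open>t\<close> depend on the random state; as only
    finitely many states exist, each fixed \<open>S\<close> can be treated separately.\<close>
  proof (rule measurable_compose_countable'[OF _ Suc])
    show "(\<lambda>\<omega>. pzf_round G S (\<omega> !! t)) \<in> pzf_space G \<rightarrow>\<^sub>M count_space (Pow (pverts G))"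
      if "S \<in> Pow (pverts G)" for S
      using that unfolding pzf_space_def
      by (intro measurable_compose[OF measurable_snth measurable_pzf_round]) auto
    show "countable (Pow (pverts G))"
      using pair_finite_verts by (simp add: countable_finite)
  qed
  then show ?case by simp
qed

text \<open>In the \<open>LEAST\<close> form measurability follows from that of the events
  \<open>blue G C \<omega> t = pverts G\<close>, and \<open>Least_Suc\<close> handles the shift by
  one round.\<close>

lemma pt_pzf_eq:
  "pt_pzf G C \<omega> = (if \<exists>t. blue G C \<omega> t = pverts G then enat (LEAST t. blue G C \<omega> t = pverts G) else \<infinity>)"
proof (cases "\<exists>t. blue G C \<omega> t = pverts G")
  case True
  then obtain t where t: "blue G C \<omega> t = pverts G" by blast
  have "(INF t\<in>{t. blue G C \<omega> t = pverts G}. enat t) = enat (LEAST t. blue G C \<omega> t = pverts G)"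
  proof (rule antisym)
    show "(INF t\<in>{t. blue G C \<omega> t = pverts G}. enat t) \<le> enat (LEAST t. blue G C \<omega> t = pverts G)"
      by (rule INF_lower) (simp add: LeastI[of "\<lambda>t. blue G C \<omega> t = pverts G", OF t])
    show "enat (LEAST t. blue G C \<omega> t = pverts G) \<le> (INF t\<in>{t. blue G C \<omega> t = pverts G}. enat t)"
      by (rule INF_greatest) (simp add: Least_le)
  qed
  with True show ?thesis by (simp add: pt_pzf_def)
qed (simp add: pt_pzf_def top_enat_def)

lemma measurable_pt_pzf [measurable]:
  assumes "C \<subseteq> pverts G"
  shows "pt_pzf G C \<in> pzf_space G \<rightarrow>\<^sub>M count_space UNIV"
proof -
  have [measurable]: "Measurable.pred (pzf_space G) (\<lambda>\<omega>. blue G C \<omega> t = pverts G)" for t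
    by (rule measurable_compose[OF measurable_blue[OF assms]]) simp
  show ?thesis unfolding pt_pzf_eq by measurable
qed

section \<open>Conditioning on the first round\<close>

lemma blue_Stream: "blue G C (x ## \<omega>) (Suc t) = blue G (pzf_round G C x) \<omega> t"
  by (induction t) auto

text \<open>The Markov property path by path: after the first round the same process runs on the
  tail of the stream.\<close>

lemma pt_pzf_Stream:
  "pt_pzf G C (x ## \<omega>) = (if C = pverts G then 0 else eSuc (pt_pzf G (pzf_round G C x) \<omega>))"
proof (cases "C = pverts G")
  case True
  then have "(LEAST t. blue G C (x ## \<omega>) t = pverts G) = 0"
    by (intro Least_equality) auto
  moreover have "\<exists>t. blue G C (x ## \<omega>) t = pverts G" using True by (intro exI[of _ 0]) auto
  ultimately show ?thesis using True by (simp add: pt_pzf_eq zero_enat_def)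
next
  case False
  let ?P = "\<lambda>t. blue G C (x ## \<omega>) t = pverts G"
  have S: "?P (Suc t) \<longleftrightarrow> blue G (pzf_round G C x) \<omega> t = pverts G" for t
    by (simp only: blue_Stream)
  have 0: "\<not> ?P 0" using False by simp
  show ?thesis
  proof (cases "\<exists>t. ?P t")
    case True
    then obtain t where t: "?P t" by blast
    have "(LEAST t. ?P t) = Suc (LEAST t. ?P (Suc t))" by (rule Least_Suc[OF t 0])
    moreover obtain s where "t = Suc s" using t 0 by (cases t) auto
    ultimately show ?thesis using False True t unfolding pt_pzf_eq S
      by (auto simp: eSuc_enat S simp del: blue.simps)
  next
    case nex: False
    then have "\<nexists>t. blue G (pzf_round G C x) \<omega> t = pverts G" using S by blast
    with nex False show ?thesis by (simp add: pt_pzf_eq del: blue.simps)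
  qed
qed

text \<open>Truncation at \<open>n\<close> makes bounds on a possibly infinite expectation
  accessible to induction on \<open>n\<close>.\<close>

lemma ept_from_eq_SUP:
  assumes "C \<subseteq> pverts G"
  shows "ept_from G C = (SUP n. \<integral>\<^sup>+\<omega>. min (ennreal_of_enat (pt_pzf G C \<omega>)) (of_nat n) \<partial>pzf_space G)"
proof -
  have [measurable]: "pt_pzf G C \<in> pzf_space G \<rightarrow>\<^sub>M count_space UNIV"
    using measurable_pt_pzf[OF assms] .
  have sup: "(SUP n. min y (of_nat n)) = y" for y :: ennreal
  proof -
    have "(SUP n. min y (of_nat n)) = min y (SUP n. of_nat n)"
      by (simp add: inf_SUP flip: inf_min)
    then show ?thesis by (simp add: ennreal_SUP_of_nat_eq_top)
  qed
  have "ept_from G C = (\<integral>\<^sup>+\<omega>. (SUP n. min (ennreal_of_enat (pt_pzf G C \<omega>)) (of_nat n)) \<partial>pzf_space G)"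
    by (simp add: ept_from_def sup)
  also have "\<dots> = (SUP n. \<integral>\<^sup>+\<omega>. min (ennreal_of_enat (pt_pzf G C \<omega>)) (of_nat n) \<partial>pzf_space G)"
    by (rule nn_integral_monotone_convergence_SUP)
       (auto simp: incseq_def le_fun_def min_le_iff_disj)
  finally show ?thesis .
qed

lemma ept_from_pverts [simp]: "ept_from G (pverts G) = 0"
proof -
  have "pt_pzf G (pverts G) \<omega> = 0" for \<omega>
    using pt_pzf_Stream[of "pverts G" "shd \<omega>" "stl \<omega>"] by simp
  then show ?thesis by (simp add: ept_from_def)
qed

text \<open>The head of the stream is independent of its tail. The equation lives in
  \<open>ennreal\<close> and allows infinite values, so by itself it does not determine
  \<open>ept_from\<close>.\<close>

lemma ept_from_step:
  assumes "C \<subset> pverts G"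
  shows "ept_from G C = 1 + (\<integral>\<^sup>+x. ept_from G (pzf_round G C x) \<partial>round_space G)"
proof -
  interpret R: prob_space "round_space G" by (rule prob_space_round_space)
  interpret Z: prob_space "stream_space (round_space G)"
    using prob_space_pzf_space unfolding pzf_space_def .
  have CV: "C \<subseteq> pverts G" "C \<noteq> pverts G" using assms by auto
  have [measurable]: "pt_pzf G S \<in> stream_space (round_space G) \<rightarrow>\<^sub>M count_space UNIV"
    if "S \<subseteq> pverts G" for S
    using measurable_pt_pzf[OF that] unfolding pzf_space_def .
  have "ept_from G C = (\<integral>\<^sup>+x. \<integral>\<^sup>+\<omega>. ennreal_of_enat (pt_pzf G C (x ## \<omega>)) \<partial>pzf_space G \<partial>round_space G)"
    unfolding ept_from_def pzf_space_def
    by (rule R.nn_integral_stream_space) (use CV in measurable)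
  also have "\<dots> = (\<integral>\<^sup>+x. 1 + ept_from G (pzf_round G C x) \<partial>round_space G)"
  proof (rule nn_integral_cong)
    fix x
    have "pzf_round G C x \<subseteq> pverts G" using pzf_round_subset[OF CV(1)] .
    then show "(\<integral>\<^sup>+\<omega>. ennreal_of_enat (pt_pzf G C (x ## \<omega>)) \<partial>pzf_space G) = 1 + ept_from G (pzf_round G C x)"
      using CV(2) by (simp add: pt_pzf_Stream ennreal_of_enat_eSuc ept_from_def pzf_space_def
          nn_integral_add Z.emeasure_space_1)
  qed
  also have "\<dots> = 1 + (\<integral>\<^sup>+x. ept_from G (pzf_round G C x) \<partial>round_space G)"
  proof (subst nn_integral_add)
    show "(\<lambda>x. ept_from G (pzf_round G C x)) \<in> borel_measurable (round_space G)"
      by (rule measurable_compose[OF measurable_pzf_round[OF CV(1)]]) simp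
  qed (simp_all add: R.emeasure_space_1)
  finally show ?thesis .
qed

section \<open>Upper bounds, and rounds with few random attempts\<close>

lemma force_prob_nonneg: "0 \<le> force_prob G C u"
  by (simp add: force_prob_def)

lemma pzf_round_superset: "C \<subseteq> pzf_round G C x"
  by (auto simp: pzf_round_def)

lemma borel_measurable_pzf_round:
  fixes f :: "'a set \<Rightarrow> ennreal"
  assumes "C \<subseteq> pverts G"
  shows "(\<lambda>x. f (pzf_round G C x)) \<in> borel_measurable (round_space G)"
  by (rule measurable_compose[OF measurable_pzf_round[OF assms]]) simp

text \<open>\<open>U\<close> dominates every truncated expectation, by induction on the truncation
  level, and hence their supremum. Looking at supersets of \<open>B\<close> suffices because blue
  vertices stay blue.\<close>

lemma ept_from_le_supersolution:
  fixes U :: "'a set \<Rightarrow> ennreal"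
  assumes U: "\<And>S. S \<subset> pverts G \<Longrightarrow> B \<subseteq> S \<Longrightarrow> 1 + (\<integral>\<^sup>+x. U (pzf_round G S x) \<partial>round_space G) \<le> U S"
    and C: "C \<subseteq> pverts G" "B \<subseteq> C"
  shows "ept_from G C \<le> U C"
proof -
  interpret R: prob_space "round_space G" by (rule prob_space_round_space)
  interpret Z: prob_space "stream_space (round_space G)"
    using prob_space_pzf_space unfolding pzf_space_def .
  have [measurable]: "pt_pzf G S \<in> stream_space (round_space G) \<rightarrow>\<^sub>M count_space UNIV"
    if "S \<subseteq> pverts G" for S
    using measurable_pt_pzf[OF that] unfolding pzf_space_def .
  let ?E = "\<lambda>n S. \<integral>\<^sup>+\<omega>. min (ennreal_of_enat (pt_pzf G S \<omega>)) (of_nat n) \<partial>pzf_space G"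
  have "?E n S \<le> U S" if "S \<subseteq> pverts G" "B \<subseteq> S" for n S
    using that
  proof (induction n arbitrary: S)
    case 0
    then show ?case by (simp add: min_absorb2)
  next
    case (Suc n)
    show ?case
    proof (cases "S = pverts G")
      case True
      have "pt_pzf G (pverts G) \<omega> = 0" for \<omega>
        using pt_pzf_Stream[of "pverts G" "shd \<omega>" "stl \<omega>"] by simp
      then show ?thesis by (simp add: True min_absorb1)
    next
      case False
      \<comment> \<open>One round uses up one unit of the truncation level.\<close>
      have min_Suc: "min (1 + y) (of_nat (Suc n)) = 1 + min y (of_nat n)" for y :: ennreal
        by (simp add: min_def ennreal_add_left_cancel_le)
      have "?E (Suc n) S = (\<integral>\<^sup>+x. \<integral>\<^sup>+\<omega>. min (ennreal_of_enat (pt_pzf G S (x ## \<omega>))) (of_nat (Suc n)) \<partial>pzf_space G \<partial>round_space G)"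
        unfolding pzf_space_def
        by (rule R.nn_integral_stream_space) (use Suc.prems in measurable)
      also have "\<dots> = (\<integral>\<^sup>+x. 1 + ?E n (pzf_round G S x) \<partial>round_space G)"
      proof (rule nn_integral_cong)
        fix x
        have "pzf_round G S x \<subseteq> pverts G" using pzf_round_subset[OF Suc.prems(1)] .
        then show "(\<integral>\<^sup>+\<omega>. min (ennreal_of_enat (pt_pzf G S (x ## \<omega>))) (of_nat (Suc n)) \<partial>pzf_space G) =
            1 + ?E n (pzf_round G S x)"
          unfolding pt_pzf_Stream
          using False by (simp only: ennreal_of_enat_eSuc min_Suc if_False)
             (simp add: pzf_space_def nn_integral_add Z.emeasure_space_1)
      qed
      also have "\<dots> \<le> (\<integral>\<^sup>+x. 1 + U (pzf_round G S x) \<partial>round_space G)"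
        by (intro nn_integral_mono add_left_mono Suc.IH)
           (use Suc.prems pzf_round_subset pzf_round_superset in blast)+
      also have "\<dots> = 1 + (\<integral>\<^sup>+x. U (pzf_round G S x) \<partial>round_space G)"
        using Suc.prems(1) by (simp add: nn_integral_add borel_measurable_pzf_round R.emeasure_space_1)
      also have "\<dots> \<le> U S" using U[of S] Suc.prems False by blast
      finally show ?thesis .
    qed
  qed
  then show ?thesis
    using C unfolding ept_from_eq_SUP[OF C(1)] by (intro SUP_least) auto
qed

lemma ept_from_sure:
  assumes C: "C \<subset> pverts G" "C \<subseteq> D"
    and new: "\<And>w. w \<in> D \<Longrightarrow> w \<notin> C \<Longrightarrow> \<exists>u\<in>C. (u, w) \<in> parcs G \<and> 1 \<le> force_prob G C u"
    and closed: "\<And>u w. u \<in> C \<Longrightarrow> (u, w) \<in> parcs G \<Longrightarrow> w \<in> D"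
    and v: "ept_from G D = ennreal v" "0 \<le> v"
  shows "ept_from G C = ennreal (1 + v)"
proof -
  interpret R: prob_space "round_space G" by (rule prob_space_round_space)
  have "AE x in round_space G. pzf_round G C x = D"
    using AE_round_space_less_1
  proof eventually_elim
    case (elim x)
    have "\<exists>u\<in>C. (u, w) \<in> parcs G \<and> x (u, w) < force_prob G C u" if "w \<in> D" "w \<notin> C" for w
      using elim new[OF that] by fastforce
    then have "w \<in> pzf_round G C x" if "w \<in> D" for w
      using that arc_snd_in_verts[of "(_, w)"] by (cases "w \<in> C") (fastforce simp: pzf_round_def nbhd_def)+
    then have "D \<subseteq> pzf_round G C x" by blast
    moreover have "pzf_round G C x \<subseteq> D"
      using C closed by (auto simp: pzf_round_def nbhd_def)
    ultimately show ?case by blast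
  qed
  then have "(\<integral>\<^sup>+x. ept_from G (pzf_round G C x) \<partial>round_space G) = (\<integral>\<^sup>+x. ept_from G D \<partial>round_space G)"
    by (intro nn_integral_cong_AE) auto
  then show ?thesis
    using v by (simp add: ept_from_step[OF C(1)] R.emeasure_space_1 ennreal_plus)
qed

text \<open>\<open>D\<close> is almost surely blue after the round, and only the two arcs can add to
  it. The integrand is arbitrary because the rule serves \<open>ept_from G\<close> and also the
  supersolution in \<open>ept_from_two_loop\<close>.\<close>

lemma nn_integral_pzf_round_two:
  fixes f :: "'a set \<Rightarrow> ennreal"
  assumes C: "C \<subset> pverts G" "C \<subseteq> D"
    and arcs: "(u1, w1) \<in> parcs G" "(u2, w2) \<in> parcs G" "(u1, w1) \<noteq> (u2, w2)"
      "u1 \<in> C" "u2 \<in> C" "w1 \<notin> C" "w2 \<notin> C"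
    and p: "force_prob G C u1 = p" "p \<le> 1" and q: "force_prob G C u2 = q" "q \<le> 1"
    and new: "\<And>w. w \<in> D \<Longrightarrow> w \<notin> C \<Longrightarrow> \<exists>u\<in>C. (u, w) \<in> parcs G \<and> 1 \<le> force_prob G C u"
    and closed: "\<And>u w. u \<in> C \<Longrightarrow> (u, w) \<in> parcs G \<Longrightarrow>
      (u, w) \<noteq> (u1, w1) \<Longrightarrow> (u, w) \<noteq> (u2, w2) \<Longrightarrow> w \<in> D"
  shows "(\<integral>\<^sup>+x. f (pzf_round G C x) \<partial>round_space G) =
    ennreal (p * q) * f (insert w1 (insert w2 D)) + ennreal (p * (1 - q)) * f (insert w1 D)
    + ennreal ((1 - p) * q) * f (insert w2 D) + ennreal ((1 - p) * (1 - q)) * f D"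
proof -
  have "AE x in round_space G. pzf_round G C x =
     D \<union> (if x (u1, w1) < p then {w1} else {}) \<union> (if x (u2, w2) < q then {w2} else {})"
    using AE_round_space_less_1
  proof eventually_elim
    case (elim x)
    have s: "\<exists>u\<in>C. (u, w) \<in> parcs G \<and> x (u, w) < force_prob G C u" if "w \<in> D" "w \<notin> C" for w
      using elim new[OF that] by fastforce
    have V: "w1 \<in> pverts G" "w2 \<in> pverts G"
      using arcs(1,2) by (auto dest: arc_snd_in_verts)
    show ?case (is "?l = ?r")
    proof (intro set_eqI iffI)
      fix w assume "w \<in> ?l"
      then consider "w \<in> C" | u where "u \<in> C" "(u, w) \<in> parcs G" "x (u, w) < force_prob G C u"
        by (auto simp: pzf_round_def nbhd_def)
      then show "w \<in> ?r"
      proof cases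
        case 2
        then show ?thesis using closed[of u w] p(1) q(1) by auto
      qed (use C in auto)
    next
      fix w assume "w \<in> ?r"
      then consider "w \<in> C" | "w = w1" "x (u1, w1) < p" | "w = w2" "x (u2, w2) < q"
        | "w \<notin> C" "w \<in> D"
        by (auto split: if_splits)
      then show "w \<in> ?l"
      proof cases
        case 4
        with s obtain u where "u \<in> C" "(u, w) \<in> parcs G" "x (u, w) < force_prob G C u" by blast
        then show ?thesis
          using arc_snd_in_verts[of "(u, w)"] by (auto simp: pzf_round_def nbhd_def)
      qed (use arcs V p q in \<open>auto simp: pzf_round_def nbhd_def\<close>)
    qed
  qed
  then have "(\<integral>\<^sup>+x. f (pzf_round G C x) \<partial>round_space G) =
     (\<integral>\<^sup>+x. f (D \<union> (if x (u1, w1) < p then {w1} else {}) \<union> (if x (u2, w2) < q then {w2} else {})) \<partial>round_space G)"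
    by (intro nn_integral_cong_AE) auto
  also have "\<dots> = ennreal (p * q) * f (D \<union> {w1} \<union> {w2}) + ennreal (p * (1 - q)) * f (D \<union> {w1} \<union> {})
     + ennreal ((1 - p) * q) * f (D \<union> {} \<union> {w2}) + ennreal ((1 - p) * (1 - q)) * f (D \<union> {} \<union> {})"
    using nn_integral_round_space_two[OF pair_finite_arcs arcs(1-3), of p q
       "\<lambda>b1 b2. f (D \<union> (if b1 then {w1} else {}) \<union> (if b2 then {w2} else {}))"]
      p q force_prob_nonneg[of C u1] force_prob_nonneg[of C u2] by simp
  finally show ?thesis by (simp add: insert_commute)
qed

lemma ept_from_two:
  assumes C: "C \<subset> pverts G" "C \<subseteq> D"
    and arcs: "(u1, w1) \<in> parcs G" "(u2, w2) \<in> parcs G" "(u1, w1) \<noteq> (u2, w2)"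
      "u1 \<in> C" "u2 \<in> C" "w1 \<notin> C" "w2 \<notin> C"
    and p: "force_prob G C u1 = p" "p \<le> 1" and q: "force_prob G C u2 = q" "q \<le> 1"
    and new: "\<And>w. w \<in> D \<Longrightarrow> w \<notin> C \<Longrightarrow> \<exists>u\<in>C. (u, w) \<in> parcs G \<and> 1 \<le> force_prob G C u"
    and closed: "\<And>u w. u \<in> C \<Longrightarrow> (u, w) \<in> parcs G \<Longrightarrow>
      (u, w) \<noteq> (u1, w1) \<Longrightarrow> (u, w) \<noteq> (u2, w2) \<Longrightarrow> w \<in> D"
    and v: "ept_from G (insert w1 (insert w2 D)) = ennreal v12" "ept_from G (insert w1 D) = ennreal v1"
      "ept_from G (insert w2 D) = ennreal v2" "ept_from G D = ennreal v0"
      "0 \<le> v12" "0 \<le> v1" "0 \<le> v2" "0 \<le> v0"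
  shows "ept_from G C =
    ennreal (1 + p * q * v12 + p * (1 - q) * v1 + (1 - p) * q * v2 + (1 - p) * (1 - q) * v0)"
proof -
  have "0 \<le> p" "0 \<le> q" using p q force_prob_nonneg by auto
  moreover have "(\<integral>\<^sup>+x. ept_from G (pzf_round G C x) \<partial>round_space G) =
    ennreal (p * q) * ennreal v12 + ennreal (p * (1 - q)) * ennreal v1
    + ennreal ((1 - p) * q) * ennreal v2 + ennreal ((1 - p) * (1 - q)) * ennreal v0"
    unfolding v(1-4)[symmetric]
    by (rule nn_integral_pzf_round_two[OF C arcs p q]) (use new closed in blast)+
  ultimately show ?thesis
    unfolding ept_from_step[OF C(1)]
    using p(2) q(2) v(5-8) by (simp add: ennreal_plus ennreal_mult add.assoc flip: ennreal_1)
qed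

text \<open>The second arc is a dummy: by \<open>closed\<close> its head lies in \<open>D\<close>,
  so its outcome is irrelevant and its probability cancels.\<close>

lemma ept_from_one:
  assumes C: "C \<subset> pverts G" "C \<subseteq> D"
    and arcs: "(u1, w1) \<in> parcs G" "(u2, w2) \<in> parcs G" "(u1, w1) \<noteq> (u2, w2)"
      "u1 \<in> C" "u2 \<in> C" "w1 \<notin> C" "w2 \<notin> C"
    and p: "force_prob G C u1 = p" "p \<le> 1" and q: "force_prob G C u2 \<le> 1"
    and new: "\<And>w. w \<in> D \<Longrightarrow> w \<notin> C \<Longrightarrow> \<exists>u\<in>C. (u, w) \<in> parcs G \<and> 1 \<le> force_prob G C u"
    and closed: "\<And>u w. u \<in> C \<Longrightarrow> (u, w) \<in> parcs G \<Longrightarrow> (u, w) \<noteq> (u1, w1) \<Longrightarrow> w \<in> D"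
    and v: "ept_from G (insert w1 D) = ennreal v1" "ept_from G D = ennreal v0" "0 \<le> v1" "0 \<le> v0"
  shows "ept_from G C = ennreal (1 + p * v1 + (1 - p) * v0)"
proof -
  have "insert w2 D = D" using closed[of u2 w2] arcs by auto
  then have D: "ept_from G (insert w1 (insert w2 D)) = ennreal v1" "ept_from G (insert w2 D) = ennreal v0"
    using v by auto
  define q where "q = force_prob G C u2"
  have "ept_from G C =
    ennreal (1 + p * q * v1 + p * (1 - q) * v1 + (1 - p) * q * v0 + (1 - p) * (1 - q) * v0)"
    by (rule ept_from_two[OF C arcs p q_def[symmetric] _ _ _ D(1) v(1) D(2) v(2)])
       (use q new closed v(3,4) in \<open>auto simp: q_def\<close>)
  also have "1 + p * q * v1 + p * (1 - q) * v1 + (1 - p) * q * v0 + (1 - p) * (1 - q) * v0 =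
     1 + p * v1 + (1 - p) * v0"
    by (simp add: algebra_simps)
  finally show ?thesis .
qed

text \<open>
  Two failures leave the state unchanged, so the expectation occurs on both sides of its equation.
  The supersolution bound shows that it is finite, hence that the equation can be solved.
\<close>

lemma ept_from_two_loop:
  assumes C: "C \<subset> pverts G"
    and arcs: "(u1, w1) \<in> parcs G" "(u2, w2) \<in> parcs G" "(u1, w1) \<noteq> (u2, w2)"
      "u1 \<in> C" "u2 \<in> C" "w1 \<notin> C" "w2 \<notin> C"
    and p: "force_prob G C u1 = p" "p \<le> 1" and q: "force_prob G C u2 = q" "q \<le> 1"
    and only: "\<And>u w. u \<in> C \<Longrightarrow> (u, w) \<in> parcs G \<Longrightarrow> w \<notin> C \<Longrightarrow> (u, w) = (u1, w1) \<or> (u, w) = (u2, w2)"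
    and v: "ept_from G (insert w1 (insert w2 C)) = ennreal v12" "ept_from G (insert w1 C) = ennreal v1"
      "ept_from G (insert w2 C) = ennreal v2"
      "0 \<le> v12" "0 \<le> v1" "0 \<le> v2"
    and pos: "0 < p"
  shows "ept_from G C =
    ennreal ((1 + p * q * v12 + p * (1 - q) * v1 + (1 - p) * q * v2) / (1 - (1 - p) * (1 - q)))"
proof -
  have q0: "0 \<le> q" using q force_prob_nonneg by auto
  define r where "r = p * q * v12 + p * (1 - q) * v1 + (1 - p) * q * v2"
  define s where "s = (1 - p) * (1 - q)"
  have r: "0 \<le> r" unfolding r_def using pos p(2) q(2) q0 v(4-6) by simp
  have "s \<le> (1 - p) * 1" unfolding s_def using p(2) q0 by (intro mult_left_mono) auto
  then have s: "0 \<le> s" "s < 1" using pos p(2) q(2) by (auto simp: s_def)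
  \<comment> \<open>Asking for agreement with \<open>ept_from G\<close> only away from
    \<open>C\<close> covers both the candidate \<open>U\<close> and \<open>ept_from G\<close>
    itself.\<close>
  have int: "(\<integral>\<^sup>+x. f (pzf_round G C x) \<partial>round_space G) = ennreal r + ennreal s * f C"
    if "\<And>S. S \<noteq> C \<Longrightarrow> f S = ept_from G S" for f
  proof -
    have "insert w1 (insert w2 C) \<noteq> C" "insert w1 C \<noteq> C" "insert w2 C \<noteq> C"
      using arcs by auto
    moreover have "(\<integral>\<^sup>+x. f (pzf_round G C x) \<partial>round_space G) =
      ennreal (p * q) * f (insert w1 (insert w2 C)) + ennreal (p * (1 - q)) * f (insert w1 C)
      + ennreal ((1 - p) * q) * f (insert w2 C) + ennreal ((1 - p) * (1 - q)) * f C"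
      by (rule nn_integral_pzf_round_two[OF C order_refl arcs p q]) (use only arcs in blast)+
    ultimately show ?thesis
      using that v pos p(2) q(2) q0 by (simp add: r_def s_def ennreal_plus ennreal_mult)
  qed
  \<comment> \<open>The real solution of the loop equation; \<open>s < 1\<close> because
    \<open>0 < p\<close>.\<close>
  define z where "z = (1 + r) / (1 - s)"
  have z: "0 \<le> z" "z = 1 + (r + s * z)"
    using r s by (simp_all add: z_def field_simps)
  define U where "U S = (if S = C then ennreal z else ept_from G S)" for S
  have "ept_from G C \<le> U C"
  proof (rule ept_from_le_supersolution[where B = C])
    fix S assume S: "S \<subset> pverts G" "C \<subseteq> S"
    show "1 + (\<integral>\<^sup>+x. U (pzf_round G S x) \<partial>round_space G) \<le> U S"
    proof (cases "S = C")
      case True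
      have "1 + (\<integral>\<^sup>+x. U (pzf_round G C x) \<partial>round_space G) = 1 + (ennreal r + ennreal s * ennreal z)"
        by (subst int) (auto simp: U_def)
      also have "\<dots> = ennreal (1 + (r + s * z))"
        using r s z(1) by (simp add: ennreal_plus ennreal_mult)
      also have "1 + (r + s * z) = z" using z(2) by simp
      finally show ?thesis by (simp add: True U_def)
    next
      case False
      \<comment> \<open>A strictly larger state never returns to \<open>C\<close>, so there
        \<open>U\<close> obeys the step equation exactly.\<close>
      then have "U (pzf_round G S x) = ept_from G (pzf_round G S x)" for x
        using S(2) pzf_round_superset[of S x] by (auto simp: U_def)
      then show ?thesis using False S(1) by (simp add: U_def ept_from_step)
    qed
  qed (use C in auto)
  then obtain y where y: "ept_from G C = ennreal y" "0 \<le> y"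
    by (cases "ept_from G C") (auto simp: U_def top_unique)
  have "ennreal y = 1 + (ennreal r + ennreal s * ennreal y)"
    using ept_from_step[OF C] int[of "ept_from G"] y by simp
  also have "\<dots> = ennreal (1 + (r + s * y))"
    using r s y by (simp add: ennreal_plus ennreal_mult)
  finally have "ennreal y = ennreal (1 + (r + s * y))" .
  moreover have "0 \<le> 1 + (r + s * y)" using y(2) r s by simp
  ultimately have "y = 1 + (r + s * y)" using y(2) ennreal_inj by blast
  then have "y = (1 + r) / (1 - s)" using s by (simp add: field_simps)
  then show ?thesis by (simp add: y r_def s_def add.assoc)
qed

text \<open>A potential that rises by at most one along each arc rises by at most \<open>t\<close>
  on the blue set within \<open>t\<close> rounds, whatever the outcomes.\<close>

lemma ept_from_ge_distance:
  fixes h :: "'a \<Rightarrow> nat"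
  assumes h: "\<And>u w. (u, w) \<in> parcs G \<Longrightarrow> h w \<le> Suc (h u)"
    and C: "\<And>u. u \<in> C \<Longrightarrow> h u \<le> a" and v: "v \<in> pverts G"
  shows "of_nat (h v - a) \<le> ept_from G C"
proof -
  interpret Z: prob_space "pzf_space G" by (rule prob_space_pzf_space)
  have b: "u \<in> blue G C \<omega> t \<Longrightarrow> h u \<le> a + t" for u \<omega> t
  proof (induction t arbitrary: u)
    case 0
    then show ?case using C by simp
  next
    case (Suc t)
    then consider "u \<in> blue G C \<omega> t" | u' where "u' \<in> blue G C \<omega> t" "(u', u) \<in> parcs G"
      by (auto simp: pzf_round_def nbhd_def)
    then show ?case
    proof cases
      case 1
      with Suc.IH show ?thesis by force
    next
      case 2
      with Suc.IH[of u'] h[of u' u] show ?thesis by simp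
    qed
  qed
  have "enat (h v - a) \<le> pt_pzf G C \<omega>" for \<omega>
    unfolding pt_pzf_def
    by (rule INF_greatest) (use b v in fastforce)
  then have "ennreal_of_enat (enat (h v - a)) \<le> ennreal_of_enat (pt_pzf G C \<omega>)" for \<omega>
    by (subst ennreal_of_enat_le_iff)
  then have "(\<integral>\<^sup>+\<omega>. of_nat (h v - a) \<partial>pzf_space G) \<le> ept_from G C"
    unfolding ept_from_def by (intro nn_integral_mono) simp
  then show ?thesis by (simp add: Z.emeasure_space_1)
qed

end

subsection \<open>Tadpole graphs\<close>

text \<open>
  In both values \<open>b\<close> tells whether the chord is present, \<open>p\<^sub>1, \<dots>, p\<^sub>r\<close> are blue with \<open>r \<ge> 2\<close>, and
  \<open>d = m - r\<close>. The first is the expected remaining time if exactly one of \<open>c\<^sub>2, c\<^sub>4\<close> is blue as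
  well, the second if no other vertex is. For \<open>d = 0\<close> nothing changes with probability \<open>1 / 9\<close>,
  whence the factor \<open>9 / 8\<close>.
\<close>

definition cycle_value :: "bool \<Rightarrow> nat \<Rightarrow> real" where
  "cycle_value b d = max 1 (real d) + (if b \<and> d \<le> 1 then 1 / 3 else 0)"

fun front_value :: "bool \<Rightarrow> nat \<Rightarrow> real" where
  "front_value b 0 = 9 / 8 * (1 + 4 / 9 + 4 / 9 * cycle_value b 0)"
| "front_value b (Suc d) =
    1 + 1 / 9 * front_value b d + 4 / 9 * max 1 (real d) + 4 / 9 * cycle_value b d"

lemma cycle_value_ge: "max 1 (real d) \<le> cycle_value b d"
  by (simp add: cycle_value_def)

lemma cycle_value_nonneg [simp]: "0 \<le> cycle_value b d"
  by (simp add: cycle_value_def)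

text \<open>Without the chord 17/8 is the value at \<open>d = 0\<close>, and it is the fixed point
  of x = 1 + x/9 + 8/9. The bound by \<open>d\<close> is preserved since 1 + d/9 + 8d/9 = d +
  1.\<close>

lemma front_value_ge: "max (17 / 8) (real d) \<le> front_value b d"
proof (induction d)
  case 0
  then show ?case using cycle_value_ge[of 0 b] by simp
next
  case (Suc d)
  have "max 1 (real d) \<ge> 1" "max 1 (real d) \<ge> d" by auto
  with Suc cycle_value_ge[of d b] show ?case
    unfolding front_value.simps max.bounded_iff by auto
qed

lemma front_value_nonneg [simp]: "0 \<le> front_value b d"
  using front_value_ge[of d b] by simp

text \<open>The optimal starts involve only these arguments: 1, 2, 3 for odd \<open>m\<close> and 2,
  3, 4 for even \<open>m\<close>.\<close>

lemma front_value_small: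
  "front_value b 1 = (if b then 55 / 24 else 17 / 8)"
  "front_value b 2 = (if b then 55 / 24 else 17 / 8)"
  "front_value b 3 = (if b then 655 / 216 else 217 / 72)"
  "front_value b 4 = (if b then 7783 / 1944 else 2593 / 648)"
  by (simp_all add: numeral_eq_Suc cycle_value_def)

lemma card_insert_Int: "finite A \<Longrightarrow> card (insert x A \<inter> C) =
   (if x \<in> A then card (A \<inter> C) else of_bool (x \<in> C) + card (A \<inter> C))"
  by (auto simp: Int_insert_left insert_absorb)

text \<open>One argument covers both graphs, \<open>b\<close> switching the chord on. With
  \<open>5 \<le> m\<close> the optimal start is an inner path vertex: it is \<open>j\<close> for
  \<open>m = 2 * j + 1\<close> and \<open>j - 1\<close> for \<open>m = 2 * j\<close>, at least 2 in
  both cases.\<close>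

locale tadpoles =
  fixes m :: nat and b :: bool and G :: "nat pair_pre_digraph"
  assumes m: "5 \<le> m" and G_def: "G = (if b then tadpole' m else tadpole m)"
begin

section \<open>Neighborhoods and forcing probabilities in both graphs\<close>

lemma pverts_G [simp]: "pverts G = {1..m + 3}"
  by (simp add: G_def tadpole'_def tadpole_def add_edge_def)

lemma arc_iff: "(u, w) \<in> parcs G \<longleftrightarrow>
    1 \<le> u \<and> u < m \<and> w = u + 1 \<or> 1 \<le> w \<and> w < m \<and> u = w + 1
  \<or> u = 1 \<and> w = m + 1 \<or> u = m + 1 \<and> w = 1 \<or> u = 1 \<and> w = m + 3 \<or> u = m + 3 \<and> w = 1
  \<or> u = m + 1 \<and> w = m + 2 \<or> u = m + 2 \<and> w = m + 1
  \<or> u = m + 2 \<and> w = m + 3 \<or> u = m + 3 \<and> w = m + 2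
  \<or> b \<and> (u = m + 1 \<and> w = m + 3 \<or> u = m + 3 \<and> w = m + 1)"
  by (auto simp: G_def tadpole'_def tadpole_def add_edge_def tadpole_arcs_def)

lemma parcs_subset: "parcs G \<subseteq> pverts G \<times> pverts G"
  by (auto simp: arc_iff)

sublocale pair_graph G
proof
  show "finite (parcs G)" by (rule finite_subset[OF parcs_subset]) simp
  show "symmetric (with_proj G)"
    by (auto simp: symmetric_def sym_def arcs_ends_def arc_to_ends_def arc_iff)
qed (use parcs_subset m in \<open>auto simp: arc_iff\<close>)

lemma nbhd_path: "2 \<le> u \<Longrightarrow> u < m \<Longrightarrow> nbhd G u = {u - 1, u + 1}"
  by (auto simp: nbhd_def arc_iff)

lemma nbhd_1: "nbhd G (Suc 0) = {2, m + 1, m + 3}"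
  using m by (auto simp: nbhd_def arc_iff)

lemma nbhd_c2: "nbhd G (Suc m) = {1, m + 2} \<union> (if b then {m + 3} else {})"
  using m by (auto simp: nbhd_def arc_iff)

lemma nbhd_c4: "nbhd G (m + 3) = {1, m + 2} \<union> (if b then {m + 1} else {})"
  using m by (auto simp: nbhd_def arc_iff)

lemma force_prob_path: "2 \<le> u \<Longrightarrow> u < m \<Longrightarrow> u \<in> C \<Longrightarrow>
   force_prob G C u = (1 + of_bool (u - 1 \<in> C) + of_bool (u + 1 \<in> C)) / 2"
  using nbhd_path[of u] by (cases u) (simp_all add: force_prob_def closed_nbhd_def card_insert_Int)

lemma force_prob_1: "1 \<in> C \<Longrightarrow>
   force_prob G C (Suc 0) = (1 + of_bool (2 \<in> C) + of_bool (m + 1 \<in> C) + of_bool (m + 3 \<in> C)) / 3"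
  using m by (simp add: force_prob_def closed_nbhd_def nbhd_1 card_insert_Int)

lemma force_prob_c2: "m + 1 \<in> C \<Longrightarrow> force_prob G C (Suc m) =
   (1 + of_bool (1 \<in> C) + of_bool (m + 2 \<in> C) + of_bool (b \<and> m + 3 \<in> C)) / (if b then 3 else 2)"
  using m by (simp add: force_prob_def closed_nbhd_def nbhd_c2 card_insert_Int)

lemma force_prob_c4: "m + 3 \<in> C \<Longrightarrow> force_prob G C (m + 3) =
   (1 + of_bool (1 \<in> C) + of_bool (m + 2 \<in> C) + of_bool (b \<and> m + 1 \<in> C)) / (if b then 3 else 2)"
  using m by (simp add: force_prob_def closed_nbhd_def nbhd_c4 card_insert_Int)

section \<open>Blue sets containing an initial segment of the path\<close>

lemma ept_full:
  assumes "2 \<le> r" "r \<le> m"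
  shows "ept_from G ({1..r} \<union> {m + 1..m + 3}) = ennreal (real (m - r))"
  using assms
proof (induction "m - r" arbitrary: r)
  case 0
  then have "{1..r} \<union> {m + 1..m + 3} = pverts G" by auto
  then show ?case using ept_from_pverts 0 by simp
next
  case (Suc d)
  let ?C = "{1..r} \<union> {m + 1..m + 3}"
  have "ept_from G ({1..r} \<union> {m + 1..m + 3}) = ennreal (1 + real (m - Suc r))"
  proof (rule ept_from_sure)
    have "Suc r \<notin> ?C" "Suc r \<in> pverts G" using Suc by auto
    moreover have "?C \<subseteq> pverts G" using Suc.prems by auto
    ultimately show "?C \<subset> pverts G" by blast
    show "?C \<subseteq> {1..Suc r} \<union> {m + 1..m + 3}" by auto
    show "\<exists>u\<in>?C. (u, w) \<in> parcs G \<and> 1 \<le> force_prob G ?C u"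
      if "w \<in> {1..Suc r} \<union> {m + 1..m + 3}" "w \<notin> ?C" for w
    proof
      have "w = Suc r" using that by auto
      \<comment> \<open>Vertex \<open>r\<close> has degree 2 and a blue left neighbor, so its
        forcing probability is 2/2.\<close>
      then show "(r, w) \<in> parcs G \<and> 1 \<le> force_prob G ?C r"
        using Suc.prems Suc.hyps(2) by (auto simp: force_prob_path arc_iff)
    qed (use Suc.prems in auto)
    show "w \<in> {1..Suc r} \<union> {m + 1..m + 3}" if "u \<in> ?C" "(u, w) \<in> parcs G" for u w
      using that(2,1) Suc.prems unfolding arc_iff by (elim disjE conjE) auto
    show "ept_from G ({1..Suc r} \<union> {m + 1..m + 3}) = ennreal (real (m - Suc r))"
      using Suc by (intro Suc.hyps(1)) auto
  qed simp
  then show ?case using Suc by (simp add: of_nat_diff)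
qed

text \<open>Describes the state after a round that completes the cycle; \<open>min\<close> and
  \<open>max\<close> let one formula include a front that is already at \<open>m\<close>.\<close>

lemma ept_full_min:
  assumes "2 \<le> r" "r \<le> m"
  shows "ept_from G ({1..min (Suc r) m} \<union> {m + 1..m + 3}) = ennreal (max 1 (real (m - r)) - 1)"
  using ept_full[of "min (Suc r) m"] assms m
  by (cases "r = m") (auto simp: min_def max_def of_nat_diff)

text \<open>\<open>c\<^sub>2\<close> forces \<open>c\<^sub>3\<close> with probability 2/2 without
  the chord and 3/3 with it. This takes one round even if the path is finished, hence the 1 in the
  maximum.\<close>

lemma ept_both:
  assumes "2 \<le> r" "r \<le> m"
  shows "ept_from G ({1..r} \<union> {m + 1, m + 3}) = ennreal (max 1 (real (m - r)))"
proof -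
  let ?C = "{1..r} \<union> {m + 1, m + 3}"
  have "ept_from G ?C = ennreal (1 + (max 1 (real (m - r)) - 1))"
  proof (rule ept_from_sure)
    have "m + 2 \<notin> ?C" "m + 2 \<in> pverts G" using assms by auto
    moreover have "?C \<subseteq> pverts G" using assms by auto
    ultimately show "?C \<subset> pverts G" by blast
    show "?C \<subseteq> {1..min (Suc r) m} \<union> {m + 1..m + 3}" using assms by auto
    show "\<exists>u\<in>?C. (u, w) \<in> parcs G \<and> 1 \<le> force_prob G ?C u"
      if "w \<in> {1..min (Suc r) m} \<union> {m + 1..m + 3}" "w \<notin> ?C" for w
    proof -
      have "w = Suc r \<and> r < m \<or> w = m + 2" using that by (auto simp: min_def split: if_splits)
      then show ?thesis
      proof
        assume "w = Suc r \<and> r < m"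
        then show ?thesis using assms by (intro bexI[of _ r]) (auto simp: force_prob_path arc_iff)
      next
        assume "w = m + 2"
        then show ?thesis using assms by (intro bexI[of _ "m + 1"]) (auto simp: force_prob_c2 arc_iff)
      qed
    qed
    show "w \<in> {1..min (Suc r) m} \<union> {m + 1..m + 3}" if "u \<in> ?C" "(u, w) \<in> parcs G" for u w
      using that(2,1) assms unfolding arc_iff by (elim disjE conjE) auto
  qed (use ept_full_min[OF assms] in auto)
  then show ?thesis by simp
qed

text \<open>By symmetry \<open>c\<close> may be \<open>c\<^sub>2\<close> or
  \<open>c\<^sub>4\<close>. Vertex \<open>1\<close> has three blue vertices in its closed
  neighborhood and degree 3, so \<open>c'\<close> is certain; \<open>c\<close> forces
  \<open>c\<^sub>3\<close> with probability 2/2, but only 2/3 if the chord is present.\<close>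

lemma ept_cycle:
  assumes r: "2 \<le> r" "r \<le> m" and c: "{c, c'} = {m + 1, m + 3}"
  shows "ept_from G ({1..r} \<union> {c}) = ennreal (cycle_value b (m - r))"
proof -
  let ?C = "{1..r} \<union> {c}"
  have c_cases: "c = m + 1 \<and> c' = m + 3 \<or> c = m + 3 \<and> c' = m + 1"
    using c by (auto simp: doubleton_eq_iff)
  have "m + 2 \<notin> ?C" "m + 2 \<in> pverts G" using r c_cases by auto
  moreover have "?C \<subseteq> pverts G" using r c_cases by auto
  ultimately have C: "?C \<subset> pverts G" by blast
  have closed: "w \<in> {1..min (Suc r) m} \<union> {c, c'} \<or> (u, w) = (c, m + 2)"
    if "u \<in> ?C" "(u, w) \<in> parcs G" for u w
    using that(2,1) r c_cases unfolding arc_iff by (elim disjE conjE) auto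
  have arcs: "(1, c') \<in> parcs G" "(c, m + 2) \<in> parcs G" "r < m \<Longrightarrow> (r, Suc r) \<in> parcs G"
    using r m c_cases by (auto simp: arc_iff)
  have prob_r: "r < m \<Longrightarrow> 1 \<le> force_prob G ?C r"
    using r c_cases by (auto simp: force_prob_path)
  have prob_1: "force_prob G ?C 1 = 1"
    using r c_cases by (auto simp: force_prob_1)
  have prob_c: "force_prob G ?C c = (if b then 2 / 3 else 1)"
    using r c_cases m by (auto simp: force_prob_c2 force_prob_c4)
  show ?thesis
  proof (cases b)
    case False
    have "ept_from G ?C = ennreal (1 + (max 1 (real (m - r)) - 1))"
    proof (rule ept_from_sure[OF C])
      show "?C \<subseteq> {1..min (Suc r) m} \<union> {m + 1..m + 3}" using r c_cases by auto
      show "\<exists>u\<in>?C. (u, w) \<in> parcs G \<and> 1 \<le> force_prob G ?C u"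
        if "w \<in> {1..min (Suc r) m} \<union> {m + 1..m + 3}" "w \<notin> ?C" for w
      proof -
        have "w = Suc r \<and> r < m \<or> w = m + 2 \<or> w = c'"
          using that c_cases by (auto simp: min_def split: if_splits)
        then show ?thesis
          using arcs prob_r prob_1 prob_c False r
          by (elim disjE) (intro bexI[of _ r] bexI[of _ c] bexI[of _ 1]; simp)+
      qed
      show "w \<in> {1..min (Suc r) m} \<union> {m + 1..m + 3}" if "u \<in> ?C" "(u, w) \<in> parcs G" for u w
        using closed[OF that] c_cases by auto
    qed (use ept_full_min[OF r] in auto)
    then show ?thesis using False by (simp add: cycle_value_def)
  next
    case True
    let ?D = "{1..min (Suc r) m} \<union> {c, c'}"
    have "ept_from G ?C = ennreal (1 + 2 / 3 * (max 1 (real (m - r)) - 1)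
        + (1 - 2 / 3) * max 1 (real (m - min (Suc r) m)))"
    \<comment> \<open>Only the attempt of \<open>c\<close> on \<open>c\<^sub>3\<close> is random;
      the certain attempt of \<open>1\<close> on \<open>c'\<close> fills the slot of the dummy
      arc.\<close>
    proof (rule ept_from_one[OF C, where D = ?D])
      show "(c, m + 2) \<in> parcs G" "(1, c') \<in> parcs G" "(c, m + 2) \<noteq> (1, c')"
        "c \<in> ?C" "1 \<in> ?C" "m + 2 \<notin> ?C" "c' \<notin> ?C"
        using c_cases r m by (auto simp: arc_iff)
      show "force_prob G ?C c = 2 / 3" using prob_c True by simp
      show "force_prob G ?C 1 \<le> 1" using prob_1 by simp
      show "?C \<subseteq> ?D" using r by auto
      show "\<exists>u\<in>?C. (u, w) \<in> parcs G \<and> 1 \<le> force_prob G ?C u"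
        if "w \<in> ?D" "w \<notin> ?C" for w
      proof -
        have "w = Suc r \<and> r < m \<or> w = c'"
          using that by (auto simp: min_def split: if_splits)
        then show ?thesis
          using arcs prob_r prob_1 r by (elim disjE) (intro bexI[of _ r] bexI[of _ 1]; simp)+
      qed
      show "w \<in> ?D" if "u \<in> ?C" "(u, w) \<in> parcs G" "(u, w) \<noteq> (c, m + 2)" for u w
        using closed[OF that(1,2)] that(3) by blast
      have "insert (m + 2) ?D = {1..min (Suc r) m} \<union> {m + 1..m + 3}"
        using c_cases by auto
      then show "ept_from G (insert (m + 2) ?D) = ennreal (max 1 (real (m - r)) - 1)"
        using ept_full_min[OF r] by simp
      show "ept_from G ?D = ennreal (max 1 (real (m - min (Suc r) m)))"
        using ept_both[of "min (Suc r) m"] r m unfolding c by simp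
    qed auto
    also have "1 + 2 / 3 * (max 1 (real (m - r)) - 1) + (1 - 2 / 3) * max 1 (real (m - min (Suc r) m))
        = cycle_value b (m - r)"
    \<comment> \<open>A failure costs time only if \<open>m - r \<le> 1\<close>; otherwise
      \<open>c\<^sub>3\<close> still turns blue no later than \<open>p\<^sub>m\<close>.\<close>
    proof -
      have "m - min (Suc r) m = m - r - 1" by (auto simp: min_def)
      then show ?thesis
        using True by (cases "m - r"; cases "m - r - 1") (auto simp: cycle_value_def field_simps)
    qed
    finally show ?thesis .
  qed
qed

text \<open>Vertex \<open>1\<close> has degree 3 and only \<open>2\<close> as a blue neighbor, so it
  forces \<open>c\<^sub>2\<close> and \<open>c\<^sub>4\<close> independently with probability 2/3
  each: both with 4/9, exactly one with 4/9, none with 1/9.\<close>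

lemma ept_front:
  assumes "2 \<le> r" "r \<le> m"
  shows "ept_from G {1..r} = ennreal (front_value b (m - r))"
  using assms
proof (induction "m - r" arbitrary: r)
  case 0
  then have r: "r = m" by simp
  have "ept_from G {1..m} = ennreal ((1 + 2 / 3 * (2 / 3) * 1 + 2 / 3 * (1 - 2 / 3) * cycle_value b 0
      + (1 - 2 / 3) * (2 / 3) * cycle_value b 0) / (1 - (1 - 2 / 3) * (1 - 2 / 3)))"
  proof (rule ept_from_two_loop[of _ 1 "m + 1" 1 "m + 3"])
    have "m + 1 \<notin> {1..m}" "m + 1 \<in> pverts G" "{1..m} \<subseteq> pverts G" by auto
    then show "{1..m} \<subset> pverts G" by blast
    show "(1, m + 1) \<in> parcs G" "(1, m + 3) \<in> parcs G" "(1, m + 1) \<noteq> (1, m + 3)"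
      "1 \<in> {1..m}" "1 \<in> {1..m}" "m + 1 \<notin> {1..m}" "m + 3 \<notin> {1..m}"
      using m by (auto simp: arc_iff)
    show "force_prob G {1..m} 1 = 2 / 3" "force_prob G {1..m} 1 = 2 / 3"
      using m by (auto simp: force_prob_1)
    show "(u, w) = (1, m + 1) \<or> (u, w) = (1, m + 3)"
      if "u \<in> {1..m}" "(u, w) \<in> parcs G" "w \<notin> {1..m}" for u w
      using that(2,1,3) unfolding arc_iff by (elim disjE conjE) auto
    show "ept_from G (insert (m + 1) (insert (m + 3) {1..m})) = ennreal 1"
      using ept_both[of m] m by simp
    show "ept_from G (insert (m + 1) {1..m}) = ennreal (cycle_value b 0)"
      using ept_cycle[of m "m + 1" "m + 3"] m by simp
    show "ept_from G (insert (m + 3) {1..m}) = ennreal (cycle_value b 0)"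
      using ept_cycle[of m "m + 3" "m + 1"] m by (simp add: insert_commute)
  qed auto
  then show ?case by (simp add: r)
next
  case (Suc d)
  then have r: "2 \<le> r" "r < m" "m - Suc r = d" "m - r = Suc d" by auto
  have "ept_from G {1..r} = ennreal (1 + 2 / 3 * (2 / 3) * max 1 (real d)
      + 2 / 3 * (1 - 2 / 3) * cycle_value b d + (1 - 2 / 3) * (2 / 3) * cycle_value b d
      + (1 - 2 / 3) * (1 - 2 / 3) * front_value b d)"
  proof (rule ept_from_two[of _ "{1..Suc r}" 1 "m + 1" 1 "m + 3"])
    have "m + 1 \<notin> {1..r}" "m + 1 \<in> pverts G" "{1..r} \<subseteq> pverts G" using r by auto
    then show "{1..r} \<subset> pverts G" by blast
    show "(1, m + 1) \<in> parcs G" "(1, m + 3) \<in> parcs G" "(1, m + 1) \<noteq> (1, m + 3)"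
      "1 \<in> {1..r}" "1 \<in> {1..r}" "m + 1 \<notin> {1..r}" "m + 3 \<notin> {1..r}"
      using r by (auto simp: arc_iff)
    show "force_prob G {1..r} 1 = 2 / 3" "force_prob G {1..r} 1 = 2 / 3"
      using r by (auto simp: force_prob_1)
    show "{1..r} \<subseteq> {1..Suc r}" by auto
    show "\<exists>u\<in>{1..r}. (u, w) \<in> parcs G \<and> 1 \<le> force_prob G {1..r} u"
      if "w \<in> {1..Suc r}" "w \<notin> {1..r}" for w
    proof
      have "w = Suc r" using that by auto
      then show "(r, w) \<in> parcs G \<and> 1 \<le> force_prob G {1..r} r"
        using r by (auto simp: force_prob_path arc_iff)
    qed (use r in auto)
    show "w \<in> {1..Suc r}"
      if "u \<in> {1..r}" "(u, w) \<in> parcs G" "(u, w) \<noteq> (1, m + 1)" "(u, w) \<noteq> (1, m + 3)" for u w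
      using that(2,1,3,4) r unfolding arc_iff by (elim disjE conjE) auto
    show "ept_from G (insert (m + 1) (insert (m + 3) {1..Suc r})) = ennreal (max 1 (real d))"
      using ept_both[of "Suc r"] r by simp
    show "ept_from G (insert (m + 1) {1..Suc r}) = ennreal (cycle_value b d)"
      using ept_cycle[of "Suc r" "m + 1" "m + 3"] r by simp
    show "ept_from G (insert (m + 3) {1..Suc r}) = ennreal (cycle_value b d)"
      using ept_cycle[of "Suc r" "m + 3" "m + 1"] r by (simp add: insert_commute)
    show "ept_from G {1..Suc r} = ennreal (front_value b d)"
      using Suc.hyps(1)[of "Suc r"] r by simp
  qed auto
  then show ?case by (simp add: r(4) add.assoc)
qed

section \<open>Starts in the interior of the path\<close>

lemma ept_interval:
  assumes "1 \<le> l" "l < r" "r \<le> m"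
  shows "ept_from G {l..r} = ennreal (real (l - 1) + front_value b (m - (r + l - 1)))"
  using assms
proof (induction l arbitrary: r)
  case (Suc l)
  show ?case
  proof (cases "l = 0")
    case True
    then show ?thesis using ept_front[of r] Suc.prems by simp
  next
    case False
    let ?r = "min (Suc r) m"
    \<comment> \<open>Each end of the interval that is an inner path vertex has a blue neighbor
      inside, so it forces outward with probability 2/2.\<close>
    have "ept_from G {Suc l..r} = ennreal (1 + (real (l - 1) + front_value b (m - (?r + l - 1))))"
    proof (rule ept_from_sure)
      have "m + 1 \<notin> {Suc l..r}" "m + 1 \<in> pverts G" "{Suc l..r} \<subseteq> pverts G" using Suc.prems by auto
      then show "{Suc l..r} \<subset> pverts G" by blast
      show "{Suc l..r} \<subseteq> {l..?r}" using Suc.prems by auto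
      show "\<exists>u\<in>{Suc l..r}. (u, w) \<in> parcs G \<and> 1 \<le> force_prob G {Suc l..r} u"
        if "w \<in> {l..?r}" "w \<notin> {Suc l..r}" for w
      proof -
        have "w = Suc r \<and> r < m \<or> w = l" using that by (auto simp: min_def split: if_splits)
        then show ?thesis
        proof
          assume "w = Suc r \<and> r < m"
          then show ?thesis using Suc.prems False
            by (intro bexI[of _ r]) (auto simp: force_prob_path arc_iff)
        next
          assume "w = l"
          then show ?thesis using Suc.prems False
            by (intro bexI[of _ "Suc l"]) (auto simp: force_prob_path arc_iff)
        qed
      qed
      show "w \<in> {l..?r}" if "u \<in> {Suc l..r}" "(u, w) \<in> parcs G" for u w
        using that(2,1) Suc.prems False unfolding arc_iff by (elim disjE conjE) auto
      show "ept_from G {l..?r} = ennreal (real (l - 1) + front_value b (m - (?r + l - 1)))"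
        by (rule Suc.IH) (use Suc.prems False in auto)
    qed simp
    \<comment> \<open>If the right front is already at \<open>m\<close>, both truncated differences
      are 0.\<close>
    moreover have "m - (?r + l - 1) = m - (r + Suc l - 1)"
      using Suc.prems False by (auto simp: min_def)
    ultimately show ?thesis using False by (simp add: of_nat_diff)
  qed
qed simp

text \<open>
  The first success of the single blue vertex \<open>k\<close> yields \<open>{k - 1..k}\<close>, \<open>{k - 1..k + 1}\<close> or
  \<open>{k..k + 1}\<close> with probability \<open>1 / 3\<close> each. The truncated subtraction is intended: it gives \<open>0\<close>
  if the right front is at \<open>p\<^sub>m\<close> before the left front is at \<open>p\<^sub>1\<close>.
\<close>

definition inner_value :: "nat \<Rightarrow> real" where
  "inner_value k = real k - 1 / 3
    + (front_value b (m - (2 * k - 2)) + front_value b (m - (2 * k - 1)) + front_value b (m - 2 * k)) / 3"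

lemma ept_inner:
  assumes "2 \<le> k" "k < m"
  shows "ept_from G {k} = ennreal (inner_value k)"
proof -
  let ?a = "real (k - 2) + front_value b (m - (2 * k - 1))"
  let ?b = "real (k - 2) + front_value b (m - (2 * k - 2))"
  let ?c = "real (k - 1) + front_value b (m - 2 * k)"
  have "ept_from G {k} = ennreal ((1 + 1 / 2 * (1 / 2) * ?a + 1 / 2 * (1 - 1 / 2) * ?b
      + (1 - 1 / 2) * (1 / 2) * ?c) / (1 - (1 - 1 / 2) * (1 - 1 / 2)))"
  proof (rule ept_from_two_loop[of _ k "k - 1" k "k + 1"])
    have "m + 1 \<notin> {k}" "m + 1 \<in> pverts G" "{k} \<subseteq> pverts G" using assms by auto
    then show "{k} \<subset> pverts G" by blast
    show "(k, k - 1) \<in> parcs G" "(k, k + 1) \<in> parcs G" "(k, k - 1) \<noteq> (k, k + 1)"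
      "k \<in> {k}" "k \<in> {k}" "k - 1 \<notin> {k}" "k + 1 \<notin> {k}"
      using assms by (auto simp: arc_iff)
    show "force_prob G {k} k = 1 / 2" "force_prob G {k} k = 1 / 2"
      using assms by (auto simp: force_prob_path)
    show "(u, w) = (k, k - 1) \<or> (u, w) = (k, k + 1)"
      if "u \<in> {k}" "(u, w) \<in> parcs G" "w \<notin> {k}" for u w
      using that(2,1) assms unfolding arc_iff by (elim disjE conjE) auto
    have "insert (k - 1) (insert (k + 1) {k}) = {k - 1..k + 1}" using assms by auto
    then show "ept_from G (insert (k - 1) (insert (k + 1) {k})) = ennreal ?a"
      using ept_interval[of "k - 1" "k + 1"] assms by (simp add: numeral_2_eq_2)
    have "insert (k - 1) {k} = {k - 1..k}" using assms by auto
    then show "ept_from G (insert (k - 1) {k}) = ennreal ?b"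
      using ept_interval[of "k - 1" k] assms by (simp add: numeral_2_eq_2)
    have "insert (k + 1) {k} = {k..k + 1}" by auto
    then show "ept_from G (insert (k + 1) {k}) = ennreal ?c"
      using ept_interval[of k "k + 1"] assms by (simp add: mult_2)
  qed auto
  \<comment> \<open>The first success takes 4/3 rounds on average, and the left front then needs
    \<open>k - 2\<close>, \<open>k - 2\<close> or \<open>k - 1\<close> rounds, on average k - 5/3;
    together k - 1/3.\<close>
  also have "(1 + 1 / 2 * (1 / 2) * ?a + 1 / 2 * (1 - 1 / 2) * ?b
      + (1 - 1 / 2) * (1 / 2) * ?c) / (1 - (1 - 1 / 2) * (1 - 1 / 2)) = inner_value k"
    using assms by (simp add: inner_value_def of_nat_diff field_simps)
  finally show ?thesis .
qed

section \<open>Connectedness, and starts outside the interior of the path\<close>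

lemma pair_graph_G: "pair_graph G" ..

lemma chord_not_arc: "\<not> b \<Longrightarrow> (m + 1, m + 3) \<notin> parcs G"
  using m by (auto simp: arc_iff)

lemma connected_G: "Digraph_Component.connected (with_proj G)"
proof -
  have path: "1 \<rightarrow>\<^sup>*\<^bsub>with_proj G\<^esub> k" if "1 \<le> k" "k \<le> m" for k
    using that
  proof (induction k rule: nat_induct_at_least)
    case base
    then show ?case by (intro reachable_refl) simp
  next
    case (Suc k)
    then have "(k, Suc k) \<in> parcs G" by (simp add: arc_iff)
    with Suc show ?case by (auto intro: reachable_adj_trans)
  qed
  have "1 \<rightarrow>\<^sup>*\<^bsub>with_proj G\<^esub> k" if "k \<in> {m + 1, m + 3}" for k
  proof -
    have "(1, k) \<in> parcs G" using that by (auto simp: arc_iff)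
    then show ?thesis by auto
  qed
  moreover have "1 \<rightarrow>\<^sup>*\<^bsub>with_proj G\<^esub> (m + 2)"
  proof -
    have "(m + 1, m + 2) \<in> parcs G" by (auto simp: arc_iff)
    with calculation[of "m + 1"] show ?thesis by (auto intro: reachable_adj_trans)
  qed
  moreover have "k \<in> {1..m} \<or> k \<in> {m + 1, m + 3} \<or> k = m + 2" if "k \<in> pverts G" for k
    using that by auto
  ultimately have from1: "1 \<rightarrow>\<^sup>*\<^bsub>with_proj G\<^esub> k" if "k \<in> pverts G" for k
    using path that by auto
  have "u \<rightarrow>\<^sup>*\<^bsub>with_proj G\<^esub> v" if "u \<in> pverts G" "v \<in> pverts G" for u v
    using symmetric_reachable'[OF from1[OF that(1)]] from1[OF that(2)] by (rule reachable_trans)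
  then show ?thesis
    by (intro connectedI reachable_mk_symmetricI) auto
qed

text \<open>The plain distance bound \<open>m - 1\<close> is too weak for \<open>m = 5\<close>. In
  the first round \<open>p\<^sub>2\<close> turns blue only with probability 1/3, which improves it
  to 1 + (m - 2)/3 + 2(m - 1)/3 = m - 1/3.\<close>

lemma ept_1_ge: "ennreal (real m - 1 / 3) \<le> ept_from G {1}"
proof -
  define h where "h u = (if u \<le> m then u else 0)" for u
  have h: "h w \<le> Suc (h u)" if "(u, w) \<in> parcs G" for u w
    using that unfolding arc_iff h_def by (elim disjE conjE) auto
  have dist: "of_nat (m - a) \<le> ept_from G C" if "\<And>u. u \<in> C \<Longrightarrow> h u \<le> a" for C a
  proof -
    have "of_nat (h m - a) \<le> ept_from G C"
      by (rule ept_from_ge_distance) (use h that m in auto)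
    then show ?thesis by (simp add: h_def)
  qed
  have "m \<in> pverts G" "m \<noteq> 1" "1 \<in> pverts G" using m by auto
  then have C: "{1} \<subset> pverts G" by blast
  have fp: "force_prob G {1} 1 = 1 / 3" using m by (simp add: force_prob_1)
  have mix: "ennreal (p1 * x1 + p2 * x2 + p3 * x3 + p4 * x4) =
      ennreal p1 * ennreal x1 + ennreal p2 * ennreal x2 + ennreal p3 * ennreal x3 + ennreal p4 * ennreal x4"
    if "0 \<le> p1" "0 \<le> p2" "0 \<le> p3" "0 \<le> p4" "0 \<le> x1" "0 \<le> x2" "0 \<le> x3" "0 \<le> x4" for p1 p2 p3 p4 x1 x2 x3 x4
    using that by (simp add: ennreal_plus ennreal_mult)
  \<comment> \<open>Only the arc \<open>(1, 2)\<close> matters; \<open>(1, m + 1)\<close> fills the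
    second slot of the two-arc integral.\<close>
  let ?f = "\<lambda>b1 b2 :: bool. ennreal (if b1 then real m - 2 else real m - 1)"
  have "?f (x (1, 2) < 1 / 3) (x (1, m + 1) < 1 / 3) \<le> ept_from G (pzf_round G {1} x)" for x
  proof -
    have "pzf_round G {1} x \<subseteq> {1, m + 1, m + 3} \<union> (if x (1, 2) < 1 / 3 then {2} else {})"
      using fp m by (auto simp: pzf_round_def nbhd_1)
    then have "u \<in> pzf_round G {1} x \<Longrightarrow> h u \<le> (if x (1, 2) < 1 / 3 then 2 else 1)" for u
      by (auto simp: h_def split: if_splits)
    then have "of_nat (m - (if x (1, 2) < 1 / 3 then 2 else 1)) \<le> ept_from G (pzf_round G {1} x)"
      by (intro dist)
    then show ?thesis
      using m by (simp add: ennreal_of_nat_eq_real_of_nat of_nat_diff split: if_splits)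
  qed
  then have "(\<integral>\<^sup>+x. ?f (x (1, 2) < 1 / 3) (x (1, m + 1) < 1 / 3) \<partial>round_space G)
      \<le> (\<integral>\<^sup>+x. ept_from G (pzf_round G {1} x) \<partial>round_space G)"
    by (intro nn_integral_mono)
  moreover have "(\<integral>\<^sup>+x. ?f (x (1, 2) < 1 / 3) (x (1, m + 1) < 1 / 3) \<partial>round_space G) =
    ennreal (1 / 3 * (1 / 3)) * ?f True True + ennreal (1 / 3 * (1 - 1 / 3)) * ?f True False
    + ennreal ((1 - 1 / 3) * (1 / 3)) * ?f False True
    + ennreal ((1 - 1 / 3) * (1 - 1 / 3)) * ?f False False"
    by (rule nn_integral_round_space_two[where f = ?f and ?e1.0 = "(1, 2)" and ?e2.0 = "(1, m + 1)"]) (use m in \<open>auto simp: arc_iff pair_finite_arcs\<close>)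
  moreover have "\<dots> = ennreal (1 / 3 * (1 / 3) * (real m - 2) + 1 / 3 * (1 - 1 / 3) * (real m - 2)
      + (1 - 1 / 3) * (1 / 3) * (real m - 1) + (1 - 1 / 3) * (1 - 1 / 3) * (real m - 1))"
    unfolding if_True if_False
    by (rule mix[symmetric]) (use m in auto)
  moreover have "\<dots> = ennreal (real m - 4 / 3)"
    by (rule arg_cong[where f = ennreal]) (simp add: field_simps)
  ultimately have "1 + ennreal (real m - 4 / 3) \<le> ept_from G {1}"
    unfolding ept_from_step[OF C] by (intro add_left_mono) simp
  moreover have "1 + ennreal (real m - 4 / 3) = ennreal (real m - 1 / 3)"
    using m by (simp flip: ennreal_1 ennreal_plus)
  ultimately show ?thesis by simp
qed

text \<open>The potential is the distance from \<open>p\<^sub>m\<close>; the farthest vertex,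
  \<open>c\<^sub>3\<close>, is \<open>m + 1\<close> away.\<close>

lemma ept_m_ge: "ennreal (real m - 1 / 3) \<le> ept_from G {m}"
proof -
  define h where "h u = (if u \<le> m then m - u else if u = m + 2 then m + 1 else m)" for u
  have h: "h w \<le> Suc (h u)" if "(u, w) \<in> parcs G" for u w
    using that m unfolding arc_iff h_def by (elim disjE conjE) auto
  have "of_nat (m + 1) \<le> ept_from G {m}"
    using ept_from_ge_distance[of h "{m}" 0 "m + 2", OF h] by (simp add: h_def)
  moreover have "ennreal (real m - 1 / 3) \<le> of_nat (m + 1)"
    unfolding ennreal_of_nat_eq_real_of_nat by (intro ennreal_leI) simp
  ultimately show ?thesis by (rule order_trans[rotated])
qed

text \<open>Collapsing the vertices above \<open>m\<close> to potential 0 leaves \<open>m\<close>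
  steps to \<open>p\<^sub>m\<close>.\<close>

lemma ept_c_ge:
  assumes "m < c"
  shows "ennreal (real m - 1 / 3) \<le> ept_from G {c}"
proof -
  define h where "h u = (if u \<le> m then u else 0)" for u
  have h: "h w \<le> Suc (h u)" if "(u, w) \<in> parcs G" for u w
    using that unfolding arc_iff h_def by (elim disjE conjE) auto
  have "of_nat m \<le> ept_from G {c}"
    using ept_from_ge_distance[of h "{c}" 0 m, OF h] assms m by (simp add: h_def)
  moreover have "ennreal (real m - 1 / 3) \<le> of_nat m"
    unfolding ennreal_of_nat_eq_real_of_nat by (intro ennreal_leI) simp
  ultimately show ?thesis by (rule order_trans[rotated])
qed

section \<open>Minimization over the starting vertex\<close>

lemma inner_value_ge:
  assumes "2 \<le> k"
  shows "real k + 43 / 24 \<le> inner_value k" "real m - real k + 2 / 3 \<le> inner_value k"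
proof -
  have "17 / 8 \<le> front_value b d" "real d \<le> front_value b d" for d
    using front_value_ge[of d b] by auto
  note bounds = this
  \<comment> \<open>Increasing in \<open>k\<close>, this bound excludes starts beyond the optimum;
    43/24 = 17/8 - 1/3.\<close>
  have "x + 43 / 24 \<le> x - 1 / 3 + (f1 + f2 + f3) / 3"
    if "17 / 8 \<le> f1" "17 / 8 \<le> f2" "17 / 8 \<le> f3" for x f1 f2 f3 :: real
    using that by simp
  from this[OF bounds(1) bounds(1) bounds(1)]
  show "real k + 43 / 24 \<le> inner_value k" unfolding inner_value_def .
  \<comment> \<open>Decreasing in \<open>k\<close>, this bound excludes starts closer to the cycle.
    Truncated differences dominate the real ones, so it holds for all
    \<open>k \<ge> 2\<close>.\<close>
  have "y - x + 2 / 3 \<le> x - 1 / 3 + (f1 + f2 + f3) / 3"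
    if "y - (2 * x - 2) \<le> f1" "y - (2 * x - 1) \<le> f2" "y - 2 * x \<le> f3" for x y f1 f2 f3 :: real
    using that by (simp add: field_simps)
  moreover have "real m - (2 * real k - 2) \<le> real (m - (2 * k - 2))"
    "real m - (2 * real k - 1) \<le> real (m - (2 * k - 1))" "real m - 2 * real k \<le> real (m - 2 * k)"
    using assms by linarith+
  ultimately show "real m - real k + 2 / 3 \<le> inner_value k"
    unfolding inner_value_def using bounds(2) by (meson order_trans)
qed

text \<open>All starts outside the interior of the path share the lower bound m - 1/3, so the
  minimum is decided among the inner vertices.\<close>

lemma ept_eqI:
  assumes k: "2 \<le> k" "k < m" "inner_value k = v" and v: "0 \<le> v" "v \<le> real m - 1 / 3"
    and le: "\<And>k'. 2 \<le> k' \<Longrightarrow> k' < m \<Longrightarrow> v \<le> inner_value k'"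
  shows "ept G = ennreal v"
  unfolding ept_def
proof (rule Min_eqI)
  show "finite ((\<lambda>v. ept_from G {v}) ` pverts G)" by simp
  have "ept_from G {k} = ennreal v"
    using ept_inner[OF k(1,2)] k(3) by simp
  then show "ennreal v \<in> (\<lambda>v. ept_from G {v}) ` pverts G" using k by (intro image_eqI[of _ _ k]) auto
  have large: "ennreal v \<le> ennreal (real m - 1 / 3)" using v by (intro ennreal_leI)
  fix y assume "y \<in> (\<lambda>v. ept_from G {v}) ` pverts G"
  then obtain j where j: "j \<in> pverts G" "y = ept_from G {j}" by auto
  then consider "j = 1" | "2 \<le> j" "j < m" | "j = m" | "m < j" by force
  then show "ennreal v \<le> y"
  proof cases
    case 2
    show ?thesis
      unfolding j(2) ept_inner[OF 2] by (rule ennreal_leI[OF le[OF 2]])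
  qed (use j order_trans[OF large ept_1_ge] order_trans[OF large ept_m_ge]
      order_trans[OF large ept_c_ge] in auto)
qed

section \<open>The two parities\<close>

lemma ept_odd:
  assumes "odd m"
  shows "ept G = ennreal ((real m - 1) / 2 + (if b then 1429 / 648 else 451 / 216))"
proof -
  obtain j where j: "m = 2 * j + 1" using assms by (elim oddE)
  have eq: "inner_value j = (real m - 1) / 2 + (if b then 1429 / 648 else 451 / 216)"
  proof -
    have "m - (2 * j - 2) = 3" "m - (2 * j - 1) = 2" "m - 2 * j = 1" using j m by auto
    then show ?thesis
      unfolding inner_value_def by (simp only: front_value_small) (simp add: j)
  qed
  show ?thesis
  proof (rule ept_eqI[OF _ _ eq])
    show "(real m - 1) / 2 + (if b then 1429 / 648 else 451 / 216) \<le> real m - 1 / 3"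
      using j m by simp
    fix k assume k: "2 \<le> k" "k < m"
    \<comment> \<open>The adjacent starts already lose: the two bounds give at least j + 67/24 on
      the right and j + 8/3 on the left, both above j + 1429/648.\<close>
    consider "k = j" | "real k \<ge> real j + 1" | "real k \<le> real j - 1" by linarith
    then show "(real m - 1) / 2 + (if b then 1429 / 648 else 451 / 216) \<le> inner_value k"
    proof cases
      case 1
      then show ?thesis using eq by simp
    qed (use inner_value_ge[OF k(1)] j in auto)
  qed (use j m in auto)
qed

lemma ept_even:
  assumes "even m"
  shows "ept G = ennreal (real m / 2 + (if b then 10357 / 5832 else 3331 / 1944))"
proof -
  obtain j where j: "m = 2 * j" using assms by (elim evenE)
  have eq: "inner_value (j - 1) = real m / 2 + (if b then 10357 / 5832 else 3331 / 1944)"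
  proof -
    have "m - (2 * (j - 1) - 2) = 4" "m - (2 * (j - 1) - 1) = 3" "m - 2 * (j - 1) = 2"
      using j m by auto
    moreover have "real (j - 1) = real j - 1" using j m by simp
    ultimately show ?thesis
      unfolding inner_value_def by (simp only: front_value_small) (simp add: j)
  qed
  show ?thesis
  proof (rule ept_eqI[OF _ _ eq])
    show "real m / 2 + (if b then 10357 / 5832 else 3331 / 1944) \<le> real m - 1 / 3"
      using j m by simp
    fix k assume k: "2 \<le> k" "k < m"
    \<comment> \<open>The case \<open>k = j\<close> is the tight one: 43/24 exceeds 10357/5832 by
      less than 0.02.\<close>
    consider "k = j - 1" | "real k \<ge> real j" | "real k \<le> real j - 2" by linarith
    then show "real m / 2 + (if b then 10357 / 5832 else 3331 / 1944) \<le> inner_value k"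
    proof cases
      case 1
      then show ?thesis using eq by simp
    qed (use inner_value_ge[OF k(1)] j in auto)
  qed (use j m in auto)
qed

end

section \<open>The infinite family and the four formulas\<close>

theorem theorem2p3:
  shows "infinite {n :: nat. 0 < n \<and>
            (\<exists>(G :: nat pair_pre_digraph) u v.
               pair_graph G \<and> Digraph_Component.connected (with_proj G) \<and> card (pverts G) = n \<and>
               u \<in> pverts G \<and> v \<in> pverts G \<and> u \<noteq> v \<and> (u, v) \<notin> parcs G \<and>
               ept G < ept (add_edge G u v))}
       \<and> (\<forall>m::nat. 5 \<le> m \<and> odd m \<longrightarrow>
            ept (tadpole m) = ennreal ((real m - 1) / 2 + 451 / 216) \<and>
            ept (tadpole m) = ennreal ((real m - 1) / 2 + 1353 / 648) \<and>
            ept (tadpole' m) = ennreal ((real m - 1) / 2 + 1429 / 648))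
       \<and> (\<forall>m::nat. 5 \<le> m \<and> even m \<longrightarrow>
            ept (tadpole m) = ennreal (real m / 2 + 3331 / 1944) \<and>
            ept (tadpole m) = ennreal (real m / 2 + 9993 / 5832) \<and>
            ept (tadpole' m) = ennreal (real m / 2 + 10357 / 5832))"
  (is "infinite ?N \<and> ?odd \<and> ?even")
proof (intro conjI)
  have T: "tadpoles m False (tadpole m)" "tadpoles m True (tadpole' m)" if "5 \<le> m" for m
    using that by (simp_all add: tadpoles_def)
  show odd: ?odd
    using tadpoles.ept_odd[OF T(1)] tadpoles.ept_odd[OF T(2)] by simp
  show ?even
    using tadpoles.ept_even[OF T(1)] tadpoles.ept_even[OF T(2)] by simp
  \<comment> \<open>Odd lengths \<open>m = 2 * j + 5\<close> give the orders
    \<open>m + 3 = 2 * j + 8\<close>, an infinite set.\<close>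
  have mem: "2 * j + 8 \<in> ?N" for j
  proof -
    define m where "m = 2 * j + 5"
    have m: "5 \<le> m" "odd m" by (auto simp: m_def)
    have "ept (tadpole m) < ept (add_edge (tadpole m) (m + 1) (m + 3))"
    proof -
      have "ept (tadpole m) = ennreal ((real m - 1) / 2 + 451 / 216)"
        "ept (tadpole' m) = ennreal ((real m - 1) / 2 + 1429 / 648)"
        using odd m by blast+
      \<comment> \<open>As 451/216 = 1353/648, the chord costs 76/648. Positivity of the larger
        value is what \<open>ennreal_lessI\<close> requires.\<close>
      moreover have "(real m - 1) / 2 + 451 / 216 < (real m - 1) / 2 + 1429 / 648"
        "0 < (real m - 1) / 2 + 1429 / 648"
        using m(1) by (simp_all add: add_nonneg_pos)
      ultimately show ?thesis
        unfolding tadpole'_def[symmetric] by (metis ennreal_lessI)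
    qed
    moreover note tadpoles.pair_graph_G[OF T(1)[OF m(1)]] tadpoles.connected_G[OF T(1)[OF m(1)]]
      tadpoles.chord_not_arc[OF T(1)[OF m(1)]]
    moreover have "card (pverts (tadpole m)) = 2 * j + 8"
      "m + 1 \<in> pverts (tadpole m)" "m + 3 \<in> pverts (tadpole m)" "m + 1 \<noteq> m + 3"
      by (simp_all add: tadpole_def m_def)
    ultimately show ?thesis
      unfolding mem_Collect_eq
      by (intro conjI exI[of _ "tadpole m"] exI[of _ "m + 1"] exI[of _ "m + 3"]) simp_all
  qed
  have "range (\<lambda>j. 2 * j + 8) \<subseteq> ?N" by (intro image_subsetI mem)
  moreover have "infinite (range (\<lambda>j::nat. 2 * j + 8))"
    by (intro range_inj_infinite injI) simp
  ultimately show "infinite ?N" by (rule infinite_super)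
qed

end
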